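(* Let $P^{(k)}$ be a $k$-uniform hyperpath. Let the $k$-uniform hypergraph $\mathcal{H}$ be the coalescence of the hyperpath $P^{(k)}$ at one of its non-cored vertices with a $k$-uniform hypergraph $\mathcal{H}_0$ at its vertex $v_0$. Let the $k$-uniform hypergraph $\mathcal{H}_1$ be obtained by moving $\mathcal{H}_0$ to a cored vertex of $P^{(k)}$, i.e. $\mathcal{H}_1$ is the coalescence of $P^{(k)}$ at one of its cored vertices with $\mathcal{H}_0$ at $v_0$ ($\mathcal{H}_1$ is said to be the first path-sliding transformation of $\mathcal{H}$). Then $\mathcal{H}_1\prec_\alpha\mathcal{H}$ for $k\ge3$ and $0<\alpha<1$.
   Context: Hypergraphs are finite; $k$-uniform means every hyperedge has exactly $k$ vertices. The hyperpath $P_r^{(k)}$ is obtained from the path graph with $r$ edges by inserting $k-2$ new vertices (of degree one) into each edge. A cored vertex is a vertex of degree one; here "cored" and "non-cored" refer to degrees in the hyperpath. The coalescence of two disjoint hypergraphs at vertices $x$ and $y$ is obtained by identifying $x$ with $y$. For a $k$-uniform hypergraph $\mathcal{H}$ on $[n]$, $\mathcal{A}(\mathcal{H})$ is the $k$-order $n$-dimensional tensor with entry $\frac1{(k-1)!}$ at $(i_1,\dots,i_k)$ if $\{i_1,\dots,i_k\}\in E(\mathcal{H})$ and $0$ otherwise; $\mathcal{D}(\mathcal{H})$ is the diagonal tensor of vertex degrees; $\mathcal{A}_\alpha(\mathcal{H})=\alpha\mathcal{D}(\mathcal{H})+(1-\alpha)\mathcal{A}(\mathcal{H})$. For a tensor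 $\mathcal{T}$, $\mathrm{Tr}_d(\mathcal{T})$ is the sum of the $d$-th powers of all $n(k-1)^{n-1}$ eigenvalues of $\mathcal{T}$; in particular $\mathrm{Tr}_0(\mathcal{T})=n(k-1)^{n-1}$, and for $d\ge1$ $$\mathrm{Tr}_{d}(\mathcal{T})=(k-1)^{n-1}\sum_{d_1+\cdots+d_n=d}\ \prod_{i=1}^{n}\frac{1}{(d_i(k-1))!}\Big(\sum_{\gamma\in[n]^{k-1}}(\mathcal{T})_{i\gamma}\frac{\partial}{\partial a_{i\gamma}}\Big)^{d_i}\mathrm{tr}\big(A^{d(k-1)}\big),$$ with $A=(a_{ij})$ an $n\times n$ matrix of indeterminates, $d_i\ge0$ integers, $\frac{\partial}{\partial a_{i\gamma}}=\frac{\partial}{\partial a_{i i_2}}\cdots\frac{\partial}{\partial a_{i i_k}}$ for $\gamma=i_2\cdots i_k$. $S_\alpha$-order: for $k$-uniform hypergraphs $\mathcal{G}_1,\mathcal{G}_2$ with $n$ vertices, $\mathcal{G}_1\prec_\alpha\mathcal{G}_2$ if there is $d\in\{1,\dots,n(k-1)^{n-1}-1\}$ with $\mathrm{Tr}_t(\mathcal{A}_\alpha(\mathcal{G}_1))=\mathrm{Tr}_t(\mathcal{A}_\alpha(\mathcal{G}_2))$ for $t=0,\dots,d-1$ and $\mathrm{Tr}_d(\mathcal{A}_\alpha(\mathcal{G}_1))<\mathrm{Tr}_d(\mathcal{A}_\alpha(\mathcal{G}_2))$.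
   Formalization: The vertex v_0 is assumed to lie in at least one hyperedge of H_0; if v_0 is isolated in H_0, both coalescences are isomorphic and the strict order fails. *)

theory Defs
  imports Complex_Main "HOL-Library.FuncSet" "HOL-Library.Poly_Mapping"
begin

section \<open>Hypergraphs\<close>

record 'a hypergraph =
  verts :: "'a set"
  edges :: "'a set set"

definition uniform_hypergraph :: "nat \<Rightarrow> 'a hypergraph \<Rightarrow> bool" where
  "uniform_hypergraph k G \<longleftrightarrow>
     finite (verts G) \<and> (\<forall>e\<in>edges G. e \<subseteq> verts G \<and> card e = k)"

definition vdegree :: "'a hypergraph \<Rightarrow> 'a \<Rightarrow> nat" where
  "vdegree G v = card {e \<in> edges G. v \<in> e}"

definition cored :: "'a hypergraph \<Rightarrow> 'a \<Rightarrow> bool" where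
  "cored G v \<longleftrightarrow> v \<in> verts G \<and> vdegree G v = 1"

definition non_cored :: "'a hypergraph \<Rightarrow> 'a \<Rightarrow> bool" where
  "non_cored G v \<longleftrightarrow> v \<in> verts G \<and> vdegree G v \<noteq> 1"

definition hypergraph_iso :: "'a hypergraph \<Rightarrow> 'b hypergraph \<Rightarrow> bool" where
  "hypergraph_iso G G' \<longleftrightarrow>
     (\<exists>f. bij_betw f (verts G) (verts G') \<and> edges G' = (\<lambda>e. f ` e) ` edges G)"

text \<open>
  In \<open>std_hyperpath k r\<close> the vertices \<open>Inl 0, \<dots>, Inl r\<close> are those of the path graph with
  \<open>r\<close> edges; the \<open>k - 2\<close> vertices \<open>Inr (i, j)\<close> are the ones inserted into its \<open>i\<close>-th edge.
\<close>

definition std_hyperpath :: "nat \<Rightarrow> nat \<Rightarrow> (nat + nat \<times> nat) hypergraph" where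
  "std_hyperpath k r =
     \<lparr> verts = Inl ` {0..r} \<union> Inr ` ({0..<r} \<times> {0..<k - 2}),
       edges = (\<lambda>i. {Inl i, Inl (i + 1)} \<union> Inr ` ({i} \<times> {0..<k - 2})) ` {0..<r} \<rparr>"

definition is_hyperpath :: "nat \<Rightarrow> 'a hypergraph \<Rightarrow> bool" where
  "is_hyperpath k P \<longleftrightarrow> (\<exists>r. hypergraph_iso (std_hyperpath k r) P)"

text \<open>
  Disjointness of the two hypergraphs is achieved by the sum type; the identified vertex is
  represented by \<open>Inl x\<close>.
\<close>

definition glue :: "'a \<Rightarrow> 'b \<Rightarrow> 'b \<Rightarrow> 'a + 'b" where
  "glue x y w = (if w = y then Inl x else Inr w)"

definition coalescence ::
  "'a hypergraph \<Rightarrow> 'a \<Rightarrow> 'b hypergraph \<Rightarrow> 'b \<Rightarrow> ('a + 'b) hypergraph" where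
  "coalescence G x G' y =
     \<lparr> verts = Inl ` verts G \<union> glue x y ` verts G',
       edges = (\<lambda>e. Inl ` e) ` edges G \<union> (\<lambda>e. glue x y ` e) ` edges G' \<rparr>"


section \<open>Tensors of a hypergraph\<close>

text \<open>
  A tensor of order \<open>k\<close> whose indices range over a finite set \<open>V\<close> is a function on lists; only
  its values on lists of length \<open>k\<close> over \<open>V\<close> matter. Hypergraph tensors are indexed by the
  vertices themselves instead of by \<open>1, \<dots>, n\<close>; nothing below depends on a numbering.
\<close>

type_synonym 'a tensor = "'a list \<Rightarrow> real"

definition adjacency_tensor :: "nat \<Rightarrow> 'a hypergraph \<Rightarrow> 'a tensor" where
  "adjacency_tensor k G is =
     (if length is = k \<and> set is \<in> edges G then 1 / fact (k - 1) else 0)"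

definition degree_tensor :: "nat \<Rightarrow> 'a hypergraph \<Rightarrow> 'a tensor" where
  "degree_tensor k G is =
     (if \<exists>v\<in>verts G. is = replicate k v then real (vdegree G (hd is)) else 0)"

definition A_alpha :: "real \<Rightarrow> nat \<Rightarrow> 'a hypergraph \<Rightarrow> 'a tensor" where
  "A_alpha \<alpha> k G is = \<alpha> * degree_tensor k G is + (1 - \<alpha>) * adjacency_tensor k G is"


section \<open>Traces of tensors\<close>

text \<open>
  Multivariate real polynomials in indeterminates of type \<open>'v\<close>: finitely supported maps from
  monomials, i.e. exponent vectors, to coefficients, with the convolution product.
\<close>

type_synonym 'v mpoly = "('v \<Rightarrow>\<^sub>0 nat) \<Rightarrow>\<^sub>0 real"

definition indet :: "'v \<Rightarrow> 'v mpoly" where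
  "indet v = Poly_Mapping.single (Poly_Mapping.single v 1) 1"

definition scale :: "real \<Rightarrow> 'v mpoly \<Rightarrow> 'v mpoly" where
  "scale c p = Poly_Mapping.map ((*) c) p"

definition partial_deriv :: "'v \<Rightarrow> 'v mpoly \<Rightarrow> 'v mpoly" where
  "partial_deriv v p =
     (\<Sum>m\<in>Poly_Mapping.keys p.
        Poly_Mapping.single (m - Poly_Mapping.single v 1)
          (real (Poly_Mapping.lookup m v) * Poly_Mapping.lookup p m))"

text \<open>The \<open>N\<close>-th power of the matrix of indeterminates \<open>a\<^sub>i\<^sub>j\<close> with \<open>i, j \<in> V\<close>.\<close>

fun indet_matrix_power :: "'a set \<Rightarrow> nat \<Rightarrow> 'a \<Rightarrow> 'a \<Rightarrow> ('a \<times> 'a) mpoly" where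
  "indet_matrix_power V 0 i j = (if i = j then 1 else 0)"
| "indet_matrix_power V (Suc N) i j =
     (\<Sum>l\<in>V. indet_matrix_power V N i l * indet (l, j))"

definition trace_power :: "'a set \<Rightarrow> nat \<Rightarrow> ('a \<times> 'a) mpoly" where
  "trace_power V N = (\<Sum>i\<in>V. indet_matrix_power V N i i)"

text \<open>The operator \<open>\<partial>/\<partial>a\<^sub>i\<^sub>\<gamma>\<close> for a list \<open>\<gamma>\<close> of second indices.\<close>

definition multi_deriv :: "'a \<Rightarrow> 'a list \<Rightarrow> ('a \<times> 'a) mpoly \<Rightarrow> ('a \<times> 'a) mpoly" where
  "multi_deriv i \<gamma> = foldr (\<lambda>j. partial_deriv (i, j)) \<gamma>"

definition row_operator ::
  "nat \<Rightarrow> 'a set \<Rightarrow> 'a tensor \<Rightarrow> 'a \<Rightarrow> ('a \<times> 'a) mpoly \<Rightarrow> ('a \<times> 'a) mpoly" where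
  "row_operator k V T i p =
     (\<Sum>\<gamma>\<in>{\<gamma>. set \<gamma> \<subseteq> V \<and> length \<gamma> = k - 1}. scale (T (i # \<gamma>)) (multi_deriv i \<gamma> p))"

definition row_factor ::
  "nat \<Rightarrow> 'a set \<Rightarrow> 'a tensor \<Rightarrow> ('a \<Rightarrow> nat) \<Rightarrow> 'a \<Rightarrow> ('a \<times> 'a) mpoly \<Rightarrow> ('a \<times> 'a) mpoly" where
  "row_factor k V T ds i p =
     scale (1 / fact (ds i * (k - 1))) ((row_operator k V T i ^^ ds i) p)"

text \<open>
  The product over \<open>i \<in> V\<close> of the differential operators: their composition, taken in an
  arbitrary order because they commute (\<open>comp_fun_commute_row_factor\<close> below).
\<close>

definition product_operator ::
  "nat \<Rightarrow> 'a set \<Rightarrow> 'a tensor \<Rightarrow> ('a \<Rightarrow> nat) \<Rightarrow> ('a \<times> 'a) mpoly \<Rightarrow> ('a \<times> 'a) mpoly" where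
  "product_operator k V T ds p = Finite_Set.fold (row_factor k V T ds) p V"

text \<open>
  The \<open>d\<close>-th order trace of an order-\<open>k\<close> tensor indexed by \<open>V\<close>, given by the formula of
  Morozov and Shakirov; it equals the sum of the \<open>d\<close>-th powers of all the
  \<open>n (k - 1)\<^bsup>n - 1\<^esup>\<close> eigenvalues, \<open>n = card V\<close>. For \<open>d \<ge> 1\<close> the differential operator has the same
  order \<open>d (k - 1)\<close> as the degree of the homogeneous polynomial it is applied to, so the
  result is a constant polynomial, and \<open>lookup _ 0\<close> reads off that constant.
\<close>

definition Tr :: "nat \<Rightarrow> 'a set \<Rightarrow> nat \<Rightarrow> 'a tensor \<Rightarrow> real" where
  "Tr k V d T =
     (if d = 0 then real (card V * (k - 1) ^ (card V - 1))
      else real ((k - 1) ^ (card V - 1)) *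
        (\<Sum>ds\<in>{ds \<in> V \<rightarrow>\<^sub>E UNIV. (\<Sum>i\<in>V. ds i) = d}.
           Poly_Mapping.lookup
             (product_operator k V T ds (trace_power V (d * (k - 1)))) 0))"


section \<open>The \<open>S\<^sub>\<alpha>\<close>-order\<close>

definition S_less :: "real \<Rightarrow> nat \<Rightarrow> 'a hypergraph \<Rightarrow> 'b hypergraph \<Rightarrow> bool" where
  "S_less \<alpha> k G1 G2 \<longleftrightarrow>
     uniform_hypergraph k G1 \<and> uniform_hypergraph k G2 \<and>
     card (verts G1) = card (verts G2) \<and>
     (\<exists>d\<in>{1..card (verts G1) * (k - 1) ^ (card (verts G1) - 1) - 1}.
        (\<forall>t<d. Tr k (verts G1) t (A_alpha \<alpha> k G1) = Tr k (verts G2) t (A_alpha \<alpha> k G2)) \<and>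
        Tr k (verts G1) d (A_alpha \<alpha> k G1) < Tr k (verts G2) d (A_alpha \<alpha> k G2))"


section \<open>The differential operators commute\<close>

lemma lookup_scale: "Poly_Mapping.lookup (scale c p) m = c * Poly_Mapping.lookup p m"
  unfolding scale_def by transfer (simp add: when_def)

lemma lookup_partial_deriv:
  "Poly_Mapping.lookup (partial_deriv v p) m =
     real (Poly_Mapping.lookup m v + 1) *
     Poly_Mapping.lookup p (m + Poly_Mapping.single v 1)"
proof -
  let ?s = "Poly_Mapping.single v (1::nat)"
  have *: "real (Poly_Mapping.lookup m' v) * Poly_Mapping.lookup p m' * (if m' - ?s = m then 1 else 0) =
      (if m' = m + ?s then real (Poly_Mapping.lookup m v + 1) * Poly_Mapping.lookup p (m + ?s) else 0)"
    for m' :: "'a \<Rightarrow>\<^sub>0 nat"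
  proof (cases "Poly_Mapping.lookup m' v = 0")
    case True
    then have "m' \<noteq> m + ?s" by (auto simp: lookup_add lookup_single)
    then show ?thesis using True by simp
  next
    case False
    have "m' - ?s + ?s = m'"
      by (rule poly_mapping_eqI)
        (use False in \<open>auto simp: lookup_add lookup_minus lookup_single when_def\<close>)
    then have "m' - ?s = m \<longleftrightarrow> m' = m + ?s" by auto
    then show ?thesis by (auto simp: lookup_add lookup_single)
  qed
  have "Poly_Mapping.lookup (partial_deriv v p) m =
      (\<Sum>m'\<in>Poly_Mapping.keys p. if m' = m + ?s
         then real (Poly_Mapping.lookup m v + 1) * Poly_Mapping.lookup p (m + ?s) else 0)"
    unfolding partial_deriv_def lookup_sum
    by (intro sum.cong refl) (simp only: *[symmetric], simp add: lookup_single when_def)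
  also have "\<dots> = real (Poly_Mapping.lookup m v + 1) * Poly_Mapping.lookup p (m + ?s)"
    by (subst sum.delta) (auto simp: not_in_keys_iff_lookup_eq_zero)
  finally show ?thesis .
qed

lemma partial_deriv_commute:
  "partial_deriv v (partial_deriv w p) = partial_deriv w (partial_deriv v p)"
  by (rule poly_mapping_eqI)
    (auto simp: lookup_partial_deriv lookup_add lookup_single when_def ac_simps)

definition mpoly_linear :: "('v mpoly \<Rightarrow> 'v mpoly) \<Rightarrow> bool" where
  "mpoly_linear f \<longleftrightarrow>
     (\<forall>p q. f (p + q) = f p + f q) \<and> (\<forall>c p. f (scale c p) = scale c (f p))"

lemma mpoly_linear_zero: "mpoly_linear f \<Longrightarrow> f 0 = 0"
  unfolding mpoly_linear_def by (metis add_cancel_right_right)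

lemma mpoly_linear_sum:
  "mpoly_linear f \<Longrightarrow> f (\<Sum>x\<in>S. g x) = (\<Sum>x\<in>S. f (g x))"
  by (induction S rule: infinite_finite_induct)
    (auto simp: mpoly_linear_zero, auto simp: mpoly_linear_def)

lemma mpoly_linear_partial_deriv: "mpoly_linear (partial_deriv v)"
  unfolding mpoly_linear_def
  by (auto intro!: poly_mapping_eqI simp: lookup_partial_deriv lookup_add lookup_scale algebra_simps)

lemma mpoly_linear_id: "mpoly_linear id" "mpoly_linear (\<lambda>p. p)"
  by (simp_all add: mpoly_linear_def)

lemma mpoly_linear_comp: "mpoly_linear f \<Longrightarrow> mpoly_linear g \<Longrightarrow> mpoly_linear (f \<circ> g)"
  by (simp add: mpoly_linear_def)

lemma mpoly_linear_multi_deriv: "mpoly_linear (multi_deriv i \<gamma>)"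
  unfolding multi_deriv_def
  by (induction \<gamma>)
    (simp_all add: mpoly_linear_id mpoly_linear_comp mpoly_linear_partial_deriv
      del: comp_apply)

lemma scale_sum: "scale c (\<Sum>x\<in>S. g x) = (\<Sum>x\<in>S. scale c (g x))"
  by (rule poly_mapping_eqI) (simp add: lookup_scale lookup_sum sum_distrib_left)

lemma scale_commute: "scale c (scale d p) = scale d (scale c p)"
  by (rule poly_mapping_eqI) (simp add: lookup_scale)

lemma scale_add: "scale c (p + q) = scale c p + scale c q"
  by (rule poly_mapping_eqI) (simp add: lookup_scale lookup_add algebra_simps)

lemma mpoly_linear_row_operator: "mpoly_linear (row_operator k V T i)"
  using mpoly_linear_multi_deriv[of i]
  unfolding mpoly_linear_def row_operator_def
  by (simp add: scale_add sum.distrib scale_sum scale_commute)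

lemma multi_deriv_commute:
  "multi_deriv i \<gamma> (multi_deriv j \<delta> p) = multi_deriv j \<delta> (multi_deriv i \<gamma> p)"
proof -
  have *: "partial_deriv v (multi_deriv j \<delta> q) = multi_deriv j \<delta> (partial_deriv v q)" for v q
    unfolding multi_deriv_def by (induction \<delta>) (auto simp: partial_deriv_commute[of v])
  show ?thesis
    by (induction \<gamma>) (simp_all add: multi_deriv_def *[unfolded multi_deriv_def])
qed

lemma row_operator_commute:
  "row_operator k V T i (row_operator k V T j p) = row_operator k V T j (row_operator k V T i p)"
proof -
  have scale_out: "multi_deriv i \<gamma> (scale c q) = scale c (multi_deriv i \<gamma> q)" for i \<gamma> c q
    using mpoly_linear_multi_deriv[of i \<gamma>] by (simp add: mpoly_linear_def)
  show ?thesis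
    unfolding row_operator_def mpoly_linear_sum[OF mpoly_linear_multi_deriv] scale_sum scale_out
    by (subst sum.swap)
      (simp add: scale_commute multi_deriv_commute[of i])
qed

lemma comp_fun_commute_row_factor: "comp_fun_commute (row_factor k V T ds)"
proof
  fix i j
  let ?R = "row_operator k V T"
  have lin: "mpoly_linear (?R i ^^ m)" for i m
    by (induction m)
      (simp_all add: mpoly_linear_id mpoly_linear_comp
        mpoly_linear_row_operator del: comp_apply)
  have 1: "?R i ((?R j ^^ m) p) = (?R j ^^ m) (?R i p)" for i j m p
    by (induction m) (auto simp: row_operator_commute[of k V T i])
  have 2: "(?R i ^^ m) ((?R j ^^ m') p) = (?R j ^^ m') ((?R i ^^ m) p)" for m m' p
    by (induction m) (auto simp: 1)
  show "row_factor k V T ds j \<circ> row_factor k V T ds i = row_factor k V T ds i \<circ> row_factor k V T ds j"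
    using lin[of "ds i" i] lin[of "ds j" j]
    by (auto simp: fun_eq_iff row_factor_def mpoly_linear_def 2 scale_commute)
qed

end

theory Submission
  imports Defs
begin

text \<open>
  The two hypergraphs already differ at the second trace. Expand the trace formula of order
  \<open>0 < d < k\<close> and fix exponents \<open>d\<^sub>i\<close> with support \<open>W\<close>, so \<open>|W| \<le> d < k\<close>. A monomial of
  \<open>tr (A\<^bsup>N\<^esup>)\<close> is the edge multiset of a closed walk; if all its edges start in \<open>W\<close>, they also
  end in \<open>W\<close>. A hyperedge has \<open>k > |W|\<close> vertices, so the off-diagonal entries of the tensor
  contribute nothing, and the diagonal ones only see walks that repeat a single loop. Hence
  \<open>Tr\<^sub>d (A\<^sub>\<alpha>)\<close> is \<open>(k - 1)\<^bsup>n - 1\<^esup>\<close> times the sum of the numbers \<open>(\<alpha> deg v)\<^sup>d\<close>. For \<open>d = 1\<close>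
  the coalescing vertex does not matter; for \<open>d = 2\<close> the sum contains twice the product of
  the degrees of the two identified vertices, which is larger at a vertex of degree 2.
\<close>

section \<open>Monomials of the trace of a matrix power\<close>

lemma keys_add_nat:
  fixes m m' :: "'v \<Rightarrow>\<^sub>0 nat"
  shows "Poly_Mapping.keys (m + m') = Poly_Mapping.keys m \<union> Poly_Mapping.keys m'"
  by (auto simp: in_keys_iff lookup_add)

lemma lookup_mult_indet:
  "Poly_Mapping.lookup (p * indet v) m =
     (if v \<in> Poly_Mapping.keys m then Poly_Mapping.lookup p (m - Poly_Mapping.single v 1) else 0)"
proof -
  let ?s = "Poly_Mapping.single v (1::nat)"
  \<comment> \<open>Subtraction of exponents is truncated, so removing \<open>v\<close> from
    \<open>m\<close> can be undone only if \<open>v\<close> occurs in \<open>m\<close>.\<close>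
  have shift: "a + ?s = m \<longleftrightarrow> v \<in> Poly_Mapping.keys m \<and> a = m - ?s" for a :: "'a \<Rightarrow>\<^sub>0 nat"
  proof
    assume "v \<in> Poly_Mapping.keys m \<and> a = m - ?s"
    then show "a + ?s = m"
      by (intro poly_mapping_eqI) (auto simp: lookup_add lookup_minus lookup_single in_keys_iff when_def)
  qed (auto simp: keys_add_nat)
  show ?thesis
  proof (induction p rule: Poly_Mapping.update_induct)
    case const
    then show ?case by simp
  next
    case (update f a b)
    have "Poly_Mapping.update a b f = f + Poly_Mapping.single a b"
      using update(1) by (intro poly_mapping_eqI)
        (auto simp: lookup_update lookup_add lookup_single when_def in_keys_iff)
    moreover have "Poly_Mapping.lookup (Poly_Mapping.single a b * indet v) m =
        (if v \<in> Poly_Mapping.keys m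
         then Poly_Mapping.lookup (Poly_Mapping.single a b) (m - ?s) else 0)"
      using shift[of a] by (auto simp: indet_def mult_single lookup_single when_def)
    ultimately show ?case
      using update(3) by (simp add: distrib_right lookup_add)
  qed
qed

text \<open>Peels the last step \<open>(l, j)\<close> off a walk. Multiplicities are forgotten: the
  connectivity arguments below only ask which edges a walk uses.\<close>

lemma keys_indet_matrix_power_Suc:
  assumes "m \<in> Poly_Mapping.keys (indet_matrix_power V (Suc N) i j)"
  obtains l m' where "m' \<in> Poly_Mapping.keys (indet_matrix_power V N i l)"
    "Poly_Mapping.keys m = insert (l, j) (Poly_Mapping.keys m')"
proof -
  from assms obtain l where "Poly_Mapping.lookup (indet_matrix_power V N i l * indet (l, j)) m \<noteq> 0"
    by (auto simp: in_keys_iff lookup_sum elim!: sum.not_neutral_contains_not_neutral)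
  then have m: "(l, j) \<in> Poly_Mapping.keys m"
    "m - Poly_Mapping.single (l, j) 1 \<in> Poly_Mapping.keys (indet_matrix_power V N i l)"
    by (auto simp: lookup_mult_indet in_keys_iff split: if_splits)
  have "m = (m - Poly_Mapping.single (l, j) 1) + Poly_Mapping.single (l, j) 1"
    using m(1) by (intro poly_mapping_eqI)
      (auto simp: lookup_add lookup_minus lookup_single in_keys_iff when_def)
  then have "Poly_Mapping.keys m = insert (l, j) (Poly_Mapping.keys (m - Poly_Mapping.single (l, j) 1))"
    by (metis keys_add_nat keys_single one_neq_zero Un_insert_right Un_empty_right)
  with m(2) show thesis by (rule that)
qed

lemma walk_stays_inside:
  assumes "m \<in> Poly_Mapping.keys (indet_matrix_power V N i j)"
    and "\<And>a b. (a, b) \<in> Poly_Mapping.keys m \<Longrightarrow> a \<in> S \<Longrightarrow> b \<in> S" and "i \<in> S"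
  shows "j \<in> S \<and> Poly_Mapping.keys m \<subseteq> S \<times> S"
  using assms(1,2)
proof (induction N arbitrary: j m)
  case 0
  then show ?case using \<open>i \<in> S\<close> by (auto split: if_splits)
next
  case (Suc N)
  from Suc.prems(1) obtain l m' where "m' \<in> Poly_Mapping.keys (indet_matrix_power V N i l)"
    and m: "Poly_Mapping.keys m = insert (l, j) (Poly_Mapping.keys m')"
    by (rule keys_indet_matrix_power_Suc)
  with Suc.IH[of m' l] Suc.prems(2) have "l \<in> S" "Poly_Mapping.keys m' \<subseteq> S \<times> S"
    by auto
  moreover have "j \<in> S" using Suc.prems(2)[of l j] m \<open>l \<in> S\<close> by auto
  ultimately show ?case using m by auto
qed

text \<open>Read backwards: no edge leads from \<open>S\<close> to its complement, so a walk ending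
  outside \<open>S\<close> was never inside.\<close>

lemma walk_stays_outside:
  assumes "m \<in> Poly_Mapping.keys (indet_matrix_power V N i j)"
    and "\<And>a b. (a, b) \<in> Poly_Mapping.keys m \<Longrightarrow> a \<in> S \<Longrightarrow> b \<in> S" and "j \<notin> S"
  shows "Poly_Mapping.keys m \<subseteq> (- S) \<times> (- S)"
  using assms
proof (induction N arbitrary: j m)
  case 0
  then show ?case by (auto split: if_splits)
next
  case (Suc N)
  from Suc.prems(1) obtain l m' where "m' \<in> Poly_Mapping.keys (indet_matrix_power V N i l)"
    and m: "Poly_Mapping.keys m = insert (l, j) (Poly_Mapping.keys m')"
    by (rule keys_indet_matrix_power_Suc)
  moreover have "l \<notin> S" using Suc.prems(2)[of l j] Suc.prems(3) m by auto
  ultimately have "Poly_Mapping.keys m' \<subseteq> (- S) \<times> (- S)"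
    using Suc.IH[of m' l] Suc.prems(2) by auto
  with m \<open>l \<notin> S\<close> \<open>j \<notin> S\<close> show ?case by auto
qed

text \<open>On a closed walk start and end coincide, so whichever side of \<open>S\<close> contains
  that vertex contains the whole walk.\<close>

lemma closed_walk_connected:
  assumes "m \<in> Poly_Mapping.keys (trace_power V N)"
    and "\<And>a b. (a, b) \<in> Poly_Mapping.keys m \<Longrightarrow> a \<in> S \<Longrightarrow> b \<in> S"
  shows "Poly_Mapping.keys m \<subseteq> S \<times> S \<or> Poly_Mapping.keys m \<subseteq> (- S) \<times> (- S)"
proof -
  from assms(1) obtain i where "m \<in> Poly_Mapping.keys (indet_matrix_power V N i i)"
    by (auto simp: trace_power_def in_keys_iff lookup_sum elim!: sum.not_neutral_contains_not_neutral)
  then show ?thesis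
    using walk_stays_inside[of m V N i i S] walk_stays_outside[of m V N i i S] assms(2) by blast
qed

text \<open>Edges all equal to the loop at \<open>v\<close> arise from exactly one walk, the one
  resting at \<open>v\<close>. The case \<open>N = 0\<close> is separate because the empty walk
  exists at every vertex.\<close>

lemma lookup_indet_matrix_power_loop:
  assumes "finite V" "v \<in> V" "i \<in> V"
  shows "Poly_Mapping.lookup (indet_matrix_power V N i j) (Poly_Mapping.single (v, v) N) =
    (if i = j \<and> (N = 0 \<or> j = v) then 1 else 0)"
proof (induction N arbitrary: j)
  case 0
  then show ?case by (simp add: lookup_one)
next
  case (Suc N)
  have "Poly_Mapping.single (v, v) (Suc N) - Poly_Mapping.single (v, v) 1 = Poly_Mapping.single (v, v) N"
    by (simp flip: single_diff)
  then have "Poly_Mapping.lookup (indet_matrix_power V (Suc N) i j) (Poly_Mapping.single (v, v) (Suc N)) =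
      (\<Sum>l\<in>V. if l = v then if j = v then
         Poly_Mapping.lookup (indet_matrix_power V N i l) (Poly_Mapping.single (v, v) N) else 0 else 0)"
    by (auto simp: lookup_sum lookup_mult_indet intro!: sum.cong)
  also have "\<dots> = (if i = j \<and> j = v then 1 else 0)"
    using assms Suc.IH[of v] by auto
  finally show ?case by simp
qed

lemma lookup_trace_power_loop:
  assumes "finite V" "v \<in> V" "N > 0"
  shows "Poly_Mapping.lookup (trace_power V N) (Poly_Mapping.single (v, v) N) = 1"
proof -
  have "Poly_Mapping.lookup (trace_power V N) (Poly_Mapping.single (v, v) N) =
      (\<Sum>i\<in>V. if i = v then 1 else 0)"
    unfolding trace_power_def lookup_sum
    using assms by (intro sum.cong) (auto simp: lookup_indet_matrix_power_loop)
  then show ?thesis using assms by simp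
qed


section \<open>The differential operators\<close>

text \<open>Each derivative removes one factor, so a surviving monomial came from one containing
  every indeterminate differentiated by. This ties the entries of \<open>\<gamma>\<close> to the
  edges of a walk.\<close>

lemma keys_multi_deriv:
  assumes "m \<in> Poly_Mapping.keys (multi_deriv i \<gamma> q)"
  obtains m' where "m' \<in> Poly_Mapping.keys q"
    "Poly_Mapping.keys m' = Poly_Mapping.keys m \<union> Pair i ` set \<gamma>"
  using assms
proof (induction \<gamma> arbitrary: m thesis)
  case Nil
  then show ?case by (simp add: multi_deriv_def)
next
  case (Cons j \<gamma>)
  from Cons.prems(2) have "m + Poly_Mapping.single (i, j) 1 \<in> Poly_Mapping.keys (multi_deriv i \<gamma> q)"
    by (auto simp: multi_deriv_def in_keys_iff lookup_partial_deriv)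
  then obtain m' where "m' \<in> Poly_Mapping.keys q" "Poly_Mapping.keys m' =
      Poly_Mapping.keys (m + Poly_Mapping.single (i, j) 1) \<union> Pair i ` set \<gamma>"
    using Cons.IH by blast
  then show ?case by (intro Cons.prems(1)[of m']) (auto simp: keys_add_nat)
qed

text \<open>Lowering the exponent of \<open>(i, i)\<close> from e + n to e by n derivatives gives
  the factor (e + 1) ... (e + n), a rising factorial.\<close>

lemma lookup_multi_deriv_loop:
  "Poly_Mapping.lookup (multi_deriv i (replicate n i) q) m =
     pochhammer (real (Poly_Mapping.lookup m (i, i)) + 1) n *
     Poly_Mapping.lookup q (m + Poly_Mapping.single (i, i) n)"
proof (induction n arbitrary: m)
  case 0
  then show ?case by (simp add: multi_deriv_def)
next
  case (Suc n)
  have "m + Poly_Mapping.single (i, i) 1 + Poly_Mapping.single (i, i) n =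
      m + Poly_Mapping.single (i, i) (Suc n)"
    by (simp add: add.assoc flip: single_add)
  then show ?case
    using Suc.IH[of "m + Poly_Mapping.single (i, i) 1"]
    by (simp add: multi_deriv_def lookup_partial_deriv lookup_add pochhammer_rec ac_simps)
qed

text \<open>The part of being a closed walk that is needed. Differentiation can destroy closed
  walks, but for the tensors considered here this weaker property survives the row operators for
  rows in \<open>W\<close> if \<open>card W < k\<close>.\<close>

definition closed_on :: "'a set \<Rightarrow> ('a \<times> 'a) mpoly \<Rightarrow> bool" where
  "closed_on W q \<longleftrightarrow> (\<forall>m\<in>Poly_Mapping.keys q.
     Poly_Mapping.keys m \<subseteq> W \<times> UNIV \<longrightarrow> Poly_Mapping.keys m \<subseteq> W \<times> W)"

lemma closed_on_trace_power: "closed_on W (trace_power V N)"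
  unfolding closed_on_def
proof (intro ballI impI)
  fix m assume "m \<in> Poly_Mapping.keys (trace_power V N)" and rows: "Poly_Mapping.keys m \<subseteq> W \<times> UNIV"
  \<comment> \<open>Taken for the complement of \<open>W\<close>: no edge starts there, so it is
    trivially closed under successors.\<close>
  then have "Poly_Mapping.keys m \<subseteq> (- W) \<times> (- W) \<or> Poly_Mapping.keys m \<subseteq> (- (- W)) \<times> (- (- W))"
    by (intro closed_walk_connected) auto
  with rows show "Poly_Mapping.keys m \<subseteq> W \<times> W" by auto
qed

text \<open>Only \<open>\<gamma> = replicate (k - 1) i\<close> contributes: a monomial surviving any
  other derivative forces all of \<open>i # \<gamma>\<close> into \<open>W\<close>, too few vertices
  for the \<open>k\<close> distinct indices of a nonzero off-diagonal entry of
  \<open>T\<close>.\<close>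

lemma lookup_row_operator:
  assumes "finite V" "i \<in> V" "i \<in> W" "finite W" "card W < k"
    and T: "\<And>is. T is \<noteq> 0 \<Longrightarrow> (\<exists>v. is = replicate k v) \<or> card (set is) = k"
    and q: "closed_on W q" and rows: "Poly_Mapping.keys m \<subseteq> W \<times> UNIV"
  shows "Poly_Mapping.lookup (row_operator k V T i q) m =
    T (replicate k i) * pochhammer (real (Poly_Mapping.lookup m (i, i)) + 1) (k - 1) *
    Poly_Mapping.lookup q (m + Poly_Mapping.single (i, i) (k - 1))"
proof -
  let ?\<Gamma> = "{\<gamma>. set \<gamma> \<subseteq> V \<and> length \<gamma> = k - 1}"
  let ?c = "\<lambda>\<gamma>. T (i # \<gamma>) * Poly_Mapping.lookup (multi_deriv i \<gamma> q) m"
  obtain k' where k': "k = Suc k'" using \<open>card W < k\<close> by (cases k) auto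
  have "?c \<gamma> = 0" if \<gamma>: "\<gamma> \<noteq> replicate (k - 1) i" for \<gamma>
  proof (rule ccontr)
    assume "?c \<gamma> \<noteq> 0"
    then have "T (i # \<gamma>) \<noteq> 0" and "m \<in> Poly_Mapping.keys (multi_deriv i \<gamma> q)"
      by (auto simp: in_keys_iff)
    then obtain m' where "m' \<in> Poly_Mapping.keys q"
      and m': "Poly_Mapping.keys m' = Poly_Mapping.keys m \<union> Pair i ` set \<gamma>"
      by (auto elim: keys_multi_deriv)
    \<comment> \<open>The edges \<open>(i, j)\<close> with \<open>j\<close> in
      \<open>\<gamma>\<close> start in \<open>W\<close>, so \<open>m'\<close> meets the premise of
      \<open>closed_on\<close> and they end in \<open>W\<close> as well.\<close>
    then have "set (i # \<gamma>) \<subseteq> W"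
      using q rows \<open>i \<in> W\<close> unfolding closed_on_def by fastforce
    then have "card (set (i # \<gamma>)) < k"
      using \<open>finite W\<close> \<open>card W < k\<close> by (meson card_mono le_less_trans)
    with T[OF \<open>T (i # \<gamma>) \<noteq> 0\<close>] \<gamma> show False by (auto simp: k')
  qed
  then have "(\<Sum>\<gamma>\<in>?\<Gamma>. ?c \<gamma>) = (\<Sum>\<gamma>\<in>{replicate (k - 1) i}. ?c \<gamma>)"
    using \<open>finite V\<close> \<open>i \<in> V\<close> by (intro sum.mono_neutral_right finite_lists_length_eq) auto
  then show ?thesis
    by (simp add: row_operator_def lookup_sum lookup_scale lookup_multi_deriv_loop k')
qed

text \<open>Up to a factor, the coefficient at \<open>m\<close> is that of \<open>q\<close> at
  \<open>m\<close> with loops at \<open>i\<close> added; those loops start in \<open>W\<close>, so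
  the property of \<open>q\<close> applies.\<close>

lemma closed_on_row_operator:
  assumes "finite V" "i \<in> V" "i \<in> W" "finite W" "card W < k"
    and T: "\<And>is. T is \<noteq> 0 \<Longrightarrow> (\<exists>v. is = replicate k v) \<or> card (set is) = k"
    and q: "closed_on W q"
  shows "closed_on W (row_operator k V T i q)"
  unfolding closed_on_def
proof (intro ballI impI)
  fix m assume m: "m \<in> Poly_Mapping.keys (row_operator k V T i q)"
    and rows: "Poly_Mapping.keys m \<subseteq> W \<times> UNIV"
  let ?m = "m + Poly_Mapping.single (i, i) (k - 1)"
  have "?m \<in> Poly_Mapping.keys q"
    using m lookup_row_operator[OF assms rows] by (auto simp: in_keys_iff)
  moreover have "Poly_Mapping.keys ?m \<subseteq> W \<times> UNIV"
    using rows \<open>i \<in> W\<close> by (auto simp: keys_add_nat split: if_splits)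
  ultimately have "Poly_Mapping.keys ?m \<subseteq> W \<times> W" using q by (auto simp: closed_on_def)
  then show "Poly_Mapping.keys m \<subseteq> W \<times> W" by (auto simp: keys_add_nat)
qed

lemma row_operator_funpow:
  assumes "finite V" "i \<in> V" "i \<in> W" "finite W" "card W < k"
    and T: "\<And>is. T is \<noteq> 0 \<Longrightarrow> (\<exists>v. is = replicate k v) \<or> card (set is) = k"
    and q: "closed_on W q"
  shows "closed_on W ((row_operator k V T i ^^ n) q)" (is ?closed)
    and "Poly_Mapping.keys m \<subseteq> W \<times> UNIV \<Longrightarrow>
      Poly_Mapping.lookup ((row_operator k V T i ^^ n) q) m =
        T (replicate k i) ^ n * pochhammer (real (Poly_Mapping.lookup m (i, i)) + 1) (n * (k - 1)) *
        Poly_Mapping.lookup q (m + Poly_Mapping.single (i, i) (n * (k - 1)))"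
proof -
  have closed: "closed_on W ((row_operator k V T i ^^ n) q)" for n
    using q by (induction n) (simp_all add: closed_on_row_operator[OF assms(1-5) T])
  then show ?closed .
  assume "Poly_Mapping.keys m \<subseteq> W \<times> UNIV"
  then show "Poly_Mapping.lookup ((row_operator k V T i ^^ n) q) m =
        T (replicate k i) ^ n * pochhammer (real (Poly_Mapping.lookup m (i, i)) + 1) (n * (k - 1)) *
        Poly_Mapping.lookup q (m + Poly_Mapping.single (i, i) (n * (k - 1)))"
  proof (induction n arbitrary: m)
    case 0
    then show ?case by simp
  next
    case (Suc n)
    let ?m = "m + Poly_Mapping.single (i, i) (k - 1)"
    have rows: "Poly_Mapping.keys ?m \<subseteq> W \<times> UNIV"
      using Suc.prems \<open>i \<in> W\<close> by (auto simp: keys_add_nat split: if_splits)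
    have m: "?m + Poly_Mapping.single (i, i) (n * (k - 1)) =
        m + Poly_Mapping.single (i, i) (Suc n * (k - 1))"
      by (simp add: add.assoc flip: single_add)
    \<comment> \<open>One application reads the remaining ones at an exponent of
      \<open>(i, i)\<close> raised by \<open>k - 1\<close>, so the two rising factorials are
      consecutive and join.\<close>
    have poch: "pochhammer (real (Poly_Mapping.lookup m (i, i)) + 1) (Suc n * (k - 1)) =
        pochhammer (real (Poly_Mapping.lookup m (i, i)) + 1) (k - 1) *
        pochhammer (real (Poly_Mapping.lookup ?m (i, i)) + 1) (n * (k - 1))"
      using pochhammer_product'[of "real (Poly_Mapping.lookup m (i, i)) + 1" "k - 1" "n * (k - 1)"]
      by (simp add: lookup_add ac_simps)
    show ?case
      unfolding poch m[symmetric]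
      using lookup_row_operator[OF assms(1-5) T closed[of n] Suc.prems] Suc.IH[OF rows]
      by simp
  qed
qed

lemma closed_on_scale: "closed_on W q \<Longrightarrow> closed_on W (scale c q)"
  by (auto simp: closed_on_def in_keys_iff lookup_scale)

lemma row_factor_zero: "ds i = 0 \<Longrightarrow> row_factor k V T ds i q = q"
  by (rule poly_mapping_eqI) (simp add: row_factor_def lookup_scale)

text \<open>The induction runs over \<open>F\<close> while \<open>W\<close> stays the support of
  \<open>ds\<close> on all of \<open>V\<close>. Loops of \<open>m\<close> at \<open>F\<close> are
  excluded so that each rising factorial starts at 1 and becomes the factorial divided out in
  \<open>row_factor\<close>.\<close>

lemma fold_row_factor:
  assumes "finite V" "F \<subseteq> V" and W: "W = {i\<in>V. ds i > 0}" "card W < k"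
    and T: "\<And>is. T is \<noteq> 0 \<Longrightarrow> (\<exists>v. is = replicate k v) \<or> card (set is) = k"
    and q: "closed_on W q"
  shows "closed_on W (Finite_Set.fold (row_factor k V T ds) q F) \<and>
    (\<forall>m. Poly_Mapping.keys m \<subseteq> W \<times> UNIV \<and> (\<forall>i\<in>F. Poly_Mapping.lookup m (i, i) = 0) \<longrightarrow>
      Poly_Mapping.lookup (Finite_Set.fold (row_factor k V T ds) q F) m =
        (\<Prod>i\<in>F. T (replicate k i) ^ ds i) *
        Poly_Mapping.lookup q (m + (\<Sum>i\<in>F. Poly_Mapping.single (i, i) (ds i * (k - 1)))))"
proof -
  interpret comp_fun_commute "row_factor k V T ds" by (rule comp_fun_commute_row_factor)
  have "finite F" using assms by (auto intro: finite_subset)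
  have "finite W" using W \<open>finite V\<close> by auto
  show ?thesis
    using \<open>finite F\<close> \<open>F \<subseteq> V\<close>
  proof (induction F rule: finite_induct)
    case empty
    then show ?case using q by simp
  next
    case (insert i F)
    let ?q = "Finite_Set.fold (row_factor k V T ds) q F"
    have fold: "Finite_Set.fold (row_factor k V T ds) q (insert i F) = row_factor k V T ds i ?q"
      using insert.hyps by simp
    from insert have closed: "closed_on W ?q"
      and IH: "\<And>m. Poly_Mapping.keys m \<subseteq> W \<times> UNIV \<Longrightarrow> \<forall>i\<in>F. Poly_Mapping.lookup m (i, i) = 0 \<Longrightarrow>
        Poly_Mapping.lookup ?q m = (\<Prod>i\<in>F. T (replicate k i) ^ ds i) *
        Poly_Mapping.lookup q (m + (\<Sum>i\<in>F. Poly_Mapping.single (i, i) (ds i * (k - 1))))"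
      by auto
    show ?case
    proof (cases "ds i = 0")
      \<comment> \<open>Here \<open>i\<close> lies outside \<open>W\<close>, so the row operator
        lemmas do not apply; the factor is the identity.\<close>
      case True
      then show ?thesis
        unfolding fold row_factor_zero[of ds i k V T, OF True]
        using closed IH insert.hyps True by simp
    next
      case False
      with insert.prems W have i: "i \<in> V" "i \<in> W" by auto
      note funpow = row_operator_funpow[OF \<open>finite V\<close> i \<open>finite W\<close> W(2) T closed]
      have "Poly_Mapping.lookup (row_factor k V T ds i ?q) m =
          (\<Prod>i\<in>insert i F. T (replicate k i) ^ ds i) * Poly_Mapping.lookup q
            (m + (\<Sum>i\<in>insert i F. Poly_Mapping.single (i, i) (ds i * (k - 1))))"
        if m: "Poly_Mapping.keys m \<subseteq> W \<times> UNIV" "\<forall>i\<in>insert i F. Poly_Mapping.lookup m (i, i) = 0" for m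
      proof -
        let ?m = "m + Poly_Mapping.single (i, i) (ds i * (k - 1))"
        have "Poly_Mapping.lookup (row_factor k V T ds i ?q) m =
            T (replicate k i) ^ ds i * Poly_Mapping.lookup ?q ?m"
          using funpow(2)[OF _ m(1)] m(2)
          by (simp add: row_factor_def lookup_scale pochhammer_fact[symmetric])
        \<comment> \<open>The new loops sit at \<open>i\<close>, outside \<open>F\<close>, so the
          induction hypothesis still sees no loops at \<open>F\<close>.\<close>
        also have "Poly_Mapping.lookup ?q ?m = (\<Prod>i\<in>F. T (replicate k i) ^ ds i) *
            Poly_Mapping.lookup q (?m + (\<Sum>i\<in>F. Poly_Mapping.single (i, i) (ds i * (k - 1))))"
          using m i insert.hyps
          by (intro IH) (auto simp: keys_add_nat lookup_add lookup_single when_def split: if_splits)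
        finally show ?thesis using insert.hyps by (simp add: ac_simps)
      qed
      moreover have "closed_on W (row_factor k V T ds i ?q)"
        unfolding row_factor_def[of k V T ds i ?q] by (intro closed_on_scale funpow)
      ultimately show ?thesis unfolding fold by blast
    qed
  qed
qed

section \<open>Traces of order below \<open>k\<close>\<close>

lemma lookup_product_operator:
  assumes "finite V" "(\<Sum>i\<in>V. ds i) < k"
    and T: "\<And>is. T is \<noteq> 0 \<Longrightarrow> (\<exists>v. is = replicate k v) \<or> card (set is) = k"
  shows "Poly_Mapping.lookup (product_operator k V T ds (trace_power V N)) 0 =
    (\<Prod>i\<in>V. T (replicate k i) ^ ds i) *
    Poly_Mapping.lookup (trace_power V N) (\<Sum>i\<in>V. Poly_Mapping.single (i, i) (ds i * (k - 1)))"
proof -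
  let ?W = "{i\<in>V. ds i > 0}"
  have "card ?W = (\<Sum>i\<in>?W. 1)" by simp
  also have "\<dots> \<le> (\<Sum>i\<in>?W. ds i)" by (intro sum_mono) auto
  also have "\<dots> \<le> (\<Sum>i\<in>V. ds i)" using \<open>finite V\<close> by (intro sum_mono2) auto
  finally have "card ?W < k" using assms by simp
  from fold_row_factor[OF \<open>finite V\<close> subset_refl refl this T closed_on_trace_power]
  show ?thesis unfolding product_operator_def by simp
qed

text \<open>The coefficient for \<open>ds\<close> looks up a product of loops. No closed walk
  consists of loops at several vertices, so only those \<open>ds\<close> concentrated in one vertex
  remain.\<close>

lemma Tr_less_order:
  assumes "finite V" "0 < d" "d < k"
    and T: "\<And>is. T is \<noteq> 0 \<Longrightarrow> (\<exists>v. is = replicate k v) \<or> card (set is) = k"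
  shows "Tr k V d T = real ((k - 1) ^ (card V - 1)) * (\<Sum>v\<in>V. T (replicate k v) ^ d)"
proof -
  let ?D = "{ds \<in> V \<rightarrow>\<^sub>E UNIV. (\<Sum>i\<in>V. ds i) = d}"
  \<comment> \<open>Restricted because the members of \<open>?D\<close> are extensional on
    \<open>V\<close>.\<close>
  let ?e = "\<lambda>v. restrict (\<lambda>i. if i = v then d else 0) V"
  let ?c = "\<lambda>ds. Poly_Mapping.lookup (product_operator k V T ds (trace_power V (d * (k - 1)))) 0"
  have "?D \<subseteq> V \<rightarrow>\<^sub>E {..d}"
    using \<open>finite V\<close> by (auto simp: PiE_iff extensional_def intro: member_le_sum)
  then have "finite ?D"
    by (rule finite_subset) (use \<open>finite V\<close> in \<open>auto intro: finite_PiE\<close>)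
  have coeff: "?c ds = (\<Prod>i\<in>V. T (replicate k i) ^ ds i) * Poly_Mapping.lookup
      (trace_power V (d * (k - 1))) (\<Sum>i\<in>V. Poly_Mapping.single (i, i) (ds i * (k - 1)))"
    if "ds \<in> ?D" for ds
    using that assms by (intro lookup_product_operator) auto
  have off: "?c ds = 0" if ds: "ds \<in> ?D - ?e ` V" for ds
  proof -
    let ?m = "\<Sum>i\<in>V. Poly_Mapping.single (i, i) (ds i * (k - 1))"
    have keys: "Poly_Mapping.keys ?m = (\<lambda>i. (i, i)) ` {i\<in>V. ds i > 0}"
    proof -
      have "Poly_Mapping.keys (\<Sum>i\<in>F. Poly_Mapping.single (i, i) (ds i * (k - 1))) =
          (\<lambda>i. (i, i)) ` {i\<in>F. ds i > 0}" if "finite F" for F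
        using that assms(2,3) by (induction F) (auto simp: keys_add_nat)
      then show ?thesis using \<open>finite V\<close> by blast
    qed
    have "(\<Sum>i\<in>V. ds i) \<noteq> 0" using ds \<open>0 < d\<close> by auto
    then obtain v where v: "v \<in> V" "ds v > 0"
      by (metis gr0I sum.neutral)
    obtain w where w: "w \<in> V" "ds w > 0" "w \<noteq> v"
    proof (rule ccontr)
      assume "\<not> thesis"
      with that have zero: "\<forall>w\<in>V - {v}. ds w = 0" by auto
      then have "(\<Sum>i\<in>V. ds i) = ds v"
        using v \<open>finite V\<close> by (simp add: sum.remove)
      then have "ds = ?e v" using ds zero
        by (intro extensionalityI[of _ V]) (auto simp: PiE_iff)
      with ds v show False by blast
    qed
    have "?m \<notin> Poly_Mapping.keys (trace_power V (d * (k - 1)))"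
    proof
      assume "?m \<in> Poly_Mapping.keys (trace_power V (d * (k - 1)))"
      \<comment> \<open>The set \<open>{v}\<close> is closed under successors since every edge is a
        loop, yet the loops at \<open>v\<close> and \<open>w\<close> lie on different sides.\<close>
      then have "Poly_Mapping.keys ?m \<subseteq> {v} \<times> {v} \<or> Poly_Mapping.keys ?m \<subseteq> (- {v}) \<times> (- {v})"
        by (rule closed_walk_connected) (unfold keys, auto)
      with v w show False unfolding keys by auto
    qed
    then show ?thesis using coeff[of ds] ds by (simp add: in_keys_iff)
  qed
  have e: "?e v \<in> ?D" if "v \<in> V" for v using that \<open>finite V\<close> by auto
  have on: "?c (?e v) = T (replicate k v) ^ d" if v: "v \<in> V" for v
  proof -
    have "(\<Sum>i\<in>V. Poly_Mapping.single (i, i) (?e v i * (k - 1))) =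
        (\<Sum>i\<in>V. if i = v then Poly_Mapping.single (v, v) (d * (k - 1)) else 0)"
      by (intro sum.cong) auto
    moreover have "(\<Prod>i\<in>V. T (replicate k i) ^ ?e v i) =
        (\<Prod>i\<in>V. if i = v then T (replicate k v) ^ d else 1)"
      by (intro prod.cong) auto
    ultimately show ?thesis
      using coeff[OF e[OF v]] v assms by (simp add: lookup_trace_power_loop)
  qed
  have inj: "inj_on ?e V"
    using \<open>0 < d\<close> by (auto simp: inj_on_def fun_eq_iff split: if_splits)
  have "(\<Sum>ds\<in>?D. ?c ds) = (\<Sum>ds\<in>?e ` V. ?c ds)"
    using \<open>finite ?D\<close> e off by (intro sum.mono_neutral_right) auto
  also have "\<dots> = (\<Sum>v\<in>V. T (replicate k v) ^ d)"
    by (simp only: sum.reindex[OF inj] o_def on cong: sum.cong)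
  finally show ?thesis unfolding Tr_def using \<open>0 < d\<close> by simp
qed

lemma Tr_A_alpha:
  assumes G: "uniform_hypergraph k G" and "0 < d" "d < k"
  shows "Tr k (verts G) d (A_alpha \<alpha> k G) =
    real ((k - 1) ^ (card (verts G) - 1)) * \<alpha> ^ d * (\<Sum>v\<in>verts G. real (vdegree G v) ^ d)"
proof -
  have diag: "A_alpha \<alpha> k G (replicate k v) = \<alpha> * real (vdegree G v)" if "v \<in> verts G" for v
  proof -
    \<comment> \<open>A constant list spans a single vertex while hyperedges have
      \<open>k > 1\<close>, so the diagonal sees only the degree tensor.\<close>
    have "set (replicate k v) \<notin> edges G"
      using G assms(2,3) by (force simp: uniform_hypergraph_def)
    moreover have "hd (replicate k v) = v" using assms(2,3) by (cases k) auto
    ultimately show ?thesis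
      using that by (auto simp: A_alpha_def degree_tensor_def adjacency_tensor_def)
  qed
  have "Tr k (verts G) d (A_alpha \<alpha> k G) = real ((k - 1) ^ (card (verts G) - 1)) *
      (\<Sum>v\<in>verts G. A_alpha \<alpha> k G (replicate k v) ^ d)"
  proof (intro Tr_less_order)
    fix "is" assume "A_alpha \<alpha> k G is \<noteq> 0"
    then show "(\<exists>v. is = replicate k v) \<or> card (set is) = k"
      using G by (auto simp: A_alpha_def degree_tensor_def adjacency_tensor_def
          uniform_hypergraph_def split: if_splits)
  qed (use assms in \<open>auto simp: uniform_hypergraph_def\<close>)
  then show ?thesis
    by (simp add: diag power_mult_distrib sum_distrib_left mult.assoc)
qed


section \<open>Degrees in a coalescence\<close>

lemma inj_glue: "inj (glue x y)"
  by (auto simp: inj_def glue_def split: if_splits)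

text \<open>The right-hand side does not mention \<open>x\<close>: moving the second hypergraph
  along the first keeps the vertex set.\<close>

lemma verts_coalescence:
  assumes "x \<in> verts G" "y \<in> verts G'"
  shows "verts (coalescence G x G' y) = Inl ` verts G \<union> Inr ` (verts G' - {y})"
  using assms by (auto simp: coalescence_def glue_def image_iff)

lemma finite_edges: "uniform_hypergraph k G \<Longrightarrow> finite (edges G)"
  unfolding uniform_hypergraph_def by (rule finite_subset[of _ "Pow (verts G)"]) auto

lemma uniform_hypergraph_coalescence:
  assumes "uniform_hypergraph k G" "uniform_hypergraph k G'"
  shows "uniform_hypergraph k (coalescence G x G' y)"
proof -
  have "card (Inl ` e :: ('a + 'b) set) = card e" for e :: "'a set"
    by (simp add: card_image)
  moreover have "card (glue x y ` e) = card e" for e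
    using inj_glue by (metis card_image inj_on_subset subset_UNIV)
  ultimately show ?thesis
    using assms by (simp add: uniform_hypergraph_def coalescence_def ball_Un)
      (blast intro: le_supI1 le_supI2 image_mono)
qed

text \<open>Edges form a set, so edges from the two sides must not collide. An edge of
  \<open>G'\<close> mapped into the range of \<open>Inl\<close> would be a subset of
  \<open>{y}\<close>, impossible for \<open>k \<ge> 2\<close>.\<close>

lemma vdegree_coalescence:
  assumes "uniform_hypergraph k G" "uniform_hypergraph k G'" "k \<ge> 2"
  shows "vdegree (coalescence G x G' y) z =
    card {e \<in> edges G. z \<in> Inl ` e} + card {e \<in> edges G'. z \<in> glue x y ` e}"
proof -
  let ?A = "{e \<in> edges G. z \<in> Inl ` e}" and ?B = "{e \<in> edges G'. z \<in> glue x y ` e}"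
  have "Inl ` e \<noteq> glue x y ` e'" if "e' \<in> edges G'" for e e'
  proof
    assume "Inl ` e = glue x y ` e'"
    then have "e' \<subseteq> {y}" by (force simp: glue_def split: if_splits)
    then have "card e' \<le> 1" by (metis card_mono finite.emptyI finite.insertI card_1_singleton_iff One_nat_def)
    with that assms show False by (auto simp: uniform_hypergraph_def)
  qed
  then have disj: "((`) Inl ` ?A) \<inter> ((`) (glue x y) ` ?B) = {}" by blast
  have "{e \<in> edges (coalescence G x G' y). z \<in> e} = ((`) Inl ` ?A) \<union> ((`) (glue x y) ` ?B)"
    by (auto simp: coalescence_def)
  then have "vdegree (coalescence G x G' y) z =
      card (((`) Inl ` ?A) :: ('a + 'b) set set) + card ((`) (glue x y) ` ?B)"
    unfolding vdegree_def using assms disj by (simp add: card_Un_disjoint finite_edges)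
  also have "card (((`) Inl ` ?A) :: ('a + 'b) set set) = card ?A"
    by (intro card_image inj_onI) (simp add: inj_image_eq_iff)
  also have "card ((`) (glue x y) ` ?B) = card ?B"
    by (intro card_image inj_onI) (simp add: inj_image_eq_iff inj_glue)
  finally show ?thesis .
qed

text \<open>\<open>g\<close> stays arbitrary to serve both first and second powers. The choice of
  \<open>x\<close> enters only through the last two terms, the change of \<open>g\<close> at the
  merged vertex.\<close>

lemma sum_vdegree_coalescence:
  fixes g :: "nat \<Rightarrow> real"
  assumes G: "uniform_hypergraph k G" and G': "uniform_hypergraph k G'" and "k \<ge> 2"
    and x: "x \<in> verts G" and y: "y \<in> verts G'"
  shows "(\<Sum>z\<in>verts (coalescence G x G' y). g (vdegree (coalescence G x G' y) z)) =
    (\<Sum>v\<in>verts G. g (vdegree G v)) + (\<Sum>v\<in>verts G' - {y}. g (vdegree G' v)) +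
    g (vdegree G x + vdegree G' y) - g (vdegree G x)"
proof -
  let ?C = "coalescence G x G' y"
  have fin: "finite (verts G)" "finite (verts G')" using G G' by (auto simp: uniform_hypergraph_def)
  note deg = vdegree_coalescence[OF G G' \<open>k \<ge> 2\<close>]
  have inl: "vdegree ?C (Inl v) = vdegree G v + (if v = x then vdegree G' y else 0)" for v
  proof -
    have "Inl v \<in> glue x y ` e \<longleftrightarrow> v = x \<and> y \<in> e" for e
      by (auto simp: glue_def image_iff)
    then show ?thesis unfolding deg unfolding vdegree_def by (auto simp: image_iff)
  qed
  have inr: "vdegree ?C (Inr v) = vdegree G' v" if "v \<noteq> y" for v
  proof -
    have "Inr v \<in> glue x y ` e \<longleftrightarrow> v \<in> e" for e
      using that by (auto simp: glue_def image_iff)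
    then show ?thesis unfolding deg unfolding vdegree_def by (auto simp: image_iff)
  qed
  have "(\<Sum>z\<in>verts ?C. g (vdegree ?C z)) =
      (\<Sum>v\<in>verts G. g (vdegree ?C (Inl v))) + (\<Sum>v\<in>verts G' - {y}. g (vdegree ?C (Inr v)))"
    unfolding verts_coalescence[OF x y]
    using fin by (subst sum.union_disjoint) (auto simp: sum.reindex)
  also have "(\<Sum>v\<in>verts G. g (vdegree ?C (Inl v))) =
      (\<Sum>v\<in>verts G. g (vdegree G v)) + g (vdegree G x + vdegree G' y) - g (vdegree G x)"
    using fin x by (simp add: inl sum.remove)
  finally show ?thesis by (simp add: inr)
qed


section \<open>Hyperpaths\<close>

lemma uniform_hyperpath:
  assumes "is_hyperpath k P" "k \<ge> 2"
  shows "uniform_hypergraph k P"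
proof -
  from assms(1) obtain r f where f: "bij_betw f (verts (std_hyperpath k r)) (verts P)"
    and E: "edges P = (\<lambda>e. f ` e) ` edges (std_hyperpath k r)"
    by (auto simp: is_hyperpath_def hypergraph_iso_def)
  have std: "e \<subseteq> verts (std_hyperpath k r) \<and> card e = k" if "e \<in> edges (std_hyperpath k r)" for e
  proof -
    from that obtain i where "i < r" and e: "e = {Inl i, Inl (i + 1)} \<union> Inr ` ({i} \<times> {0..<k - 2})"
      by (auto simp: std_hyperpath_def)
    have "card e = card {Inl i :: nat + nat \<times> nat, Inl (i + 1)} +
        card (Inr ` ({i} \<times> {0..<k - 2}) :: (nat + nat \<times> nat) set)"
      unfolding e by (intro card_Un_disjoint) auto
    also have "\<dots> = k" using \<open>k \<ge> 2\<close> by (simp add: card_image card_cartesian_product)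
    finally show ?thesis using \<open>i < r\<close> by (auto simp: e std_hyperpath_def)
  qed
  have "finite (verts P)"
    using bij_betw_finite[OF f] by (simp add: std_hyperpath_def)
  moreover have "f ` e \<subseteq> verts P \<and> card (f ` e) = k" if "e \<in> edges (std_hyperpath k r)" for e
    using std[OF that] f by (metis bij_betw_def card_image image_mono inj_on_subset)
  ultimately show ?thesis by (auto simp: uniform_hypergraph_def E)
qed

text \<open>The hyperpath with \<open>r = 0\<close> is an isolated vertex, which counts as
  \<open>non_cored\<close>; a nonempty edge set rules it out.\<close>

lemma hyperpath_no_isolated:
  assumes "is_hyperpath k P" "edges P \<noteq> {}" "v \<in> verts P"
  shows "\<exists>e\<in>edges P. v \<in> e"
proof -
  from assms(1) obtain r f where f: "bij_betw f (verts (std_hyperpath k r)) (verts P)"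
    and E: "edges P = (\<lambda>e. f ` e) ` edges (std_hyperpath k r)"
    by (auto simp: is_hyperpath_def hypergraph_iso_def)
  have "r > 0" using assms(2) E by (auto simp: std_hyperpath_def)
  from f \<open>v \<in> verts P\<close> obtain z where z: "z \<in> verts (std_hyperpath k r)" "v = f z"
    by (auto simp: bij_betw_def)
  have "\<exists>i<r. z \<in> {Inl i, Inl (i + 1)} \<union> Inr ` ({i} \<times> {0..<k - 2})"
  proof (cases z)
    case (Inl i)
    with z have "i \<le> r" by (auto simp: std_hyperpath_def)
    \<comment> \<open>Vertex \<open>i\<close> is the right end of edge \<open>i - 1\<close>; for
      \<open>i = 0\<close> truncated subtraction gives edge 0, of which it is the left end.\<close>
    then show ?thesis using Inl \<open>r > 0\<close> by (intro exI[of _ "i - 1"]) auto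
  next
    case (Inr p)
    with z show ?thesis by (auto simp: std_hyperpath_def)
  qed
  then have "\<exists>e\<in>edges (std_hyperpath k r). z \<in> e" by (simp add: std_hyperpath_def Bex_def)
  then show ?thesis using z(2) E by blast
qed

section \<open>Comparison of the two coalescences\<close>

theorem lemma4p2:
  fixes k :: nat and \<alpha> :: real
    and P :: "'a hypergraph" and H\<^sub>0 :: "'b hypergraph"
    and u w :: 'a and v\<^sub>0 :: 'b
  assumes "k \<ge> 3" and "0 < \<alpha>" and "\<alpha> < 1"
    and "is_hyperpath k P"
    and "uniform_hypergraph k H\<^sub>0" and "v\<^sub>0 \<in> verts H\<^sub>0" and "vdegree H\<^sub>0 v\<^sub>0 \<ge> 1"
    and "non_cored P u" and "cored P w"
  shows "S_less \<alpha> k (coalescence P w H\<^sub>0 v\<^sub>0) (coalescence P u H\<^sub>0 v\<^sub>0)"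
proof -
  let ?G1 = "coalescence P w H\<^sub>0 v\<^sub>0" and ?G2 = "coalescence P u H\<^sub>0 v\<^sub>0"
  have "k \<ge> 2" using \<open>k \<ge> 3\<close> by simp
  note P = uniform_hyperpath[OF \<open>is_hyperpath k P\<close> \<open>k \<ge> 2\<close>]
  have u: "u \<in> verts P" "vdegree P u \<noteq> 1" and w: "w \<in> verts P" "vdegree P w = 1"
    using assms by (auto simp: non_cored_def cored_def)
  note unif = uniform_hypergraph_coalescence[OF P \<open>uniform_hypergraph k H\<^sub>0\<close>]
  note sums = sum_vdegree_coalescence[OF P \<open>uniform_hypergraph k H\<^sub>0\<close> \<open>k \<ge> 2\<close> _ \<open>v\<^sub>0 \<in> verts H\<^sub>0\<close>]
  have V: "verts ?G1 = verts ?G2"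
    using u w \<open>v\<^sub>0 \<in> verts H\<^sub>0\<close> by (simp add: verts_coalescence)
  define n where "n = card (verts ?G2)"
  \<comment> \<open>The cored vertex supplies an edge, so \<open>P\<close> is not a single vertex
    and the non-cored \<open>u\<close> has degree at least 2.\<close>
  from w(2) obtain e where e: "e \<in> edges P"
    unfolding vdegree_def by (metis (mono_tags, lifting) card_1_singletonE insertI1 mem_Collect_eq)
  have "vdegree P u \<noteq> 0"
    using hyperpath_no_isolated[OF \<open>is_hyperpath k P\<close> _ u(1)] e finite_edges[OF P]
    by (auto simp: vdegree_def)
  with u(2) have deg_u: "vdegree P u \<ge> 2" by simp
  \<comment> \<open>Serves to place the deciding order 2 within the range of orders allowed by
    \<open>S_less\<close>.\<close>
  have n: "n \<ge> 3"
  proof -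
    have "Inl ` e \<in> edges ?G2" using e by (auto simp: coalescence_def)
    then have "k \<le> n"
      using unif[of u v\<^sub>0] unfolding uniform_hypergraph_def n_def by (metis card_mono)
    with \<open>k \<ge> 3\<close> show ?thesis by simp
  qed
  have "n * 1 \<le> n * (k - 1) ^ (n - 1)"
    using \<open>k \<ge> 3\<close> by (intro mult_left_mono) auto
  with n have "3 \<le> n * (k - 1) ^ (n - 1)" by linarith
  then have range: "2 \<in> {1..n * (k - 1) ^ (n - 1) - 1}" by simp
  define c where "c = real ((k - 1) ^ (n - 1))"
  \<comment> \<open>\<open>k \<ge> 3\<close> puts order 2 below \<open>k\<close>; \<open>c\<close>
    is common because both hypergraphs have \<open>n\<close> vertices.\<close>
  have tr: "Tr k (verts G) d (A_alpha \<alpha> k G) =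
      c * \<alpha> ^ d * (\<Sum>v\<in>verts G. real (vdegree G v) ^ d)"
    if "d \<in> {1, 2}" "G = ?G1 \<or> G = ?G2" for d G
    using that Tr_A_alpha[of k G d \<alpha>] unif \<open>k \<ge> 3\<close> V by (auto simp: c_def n_def)
  have "c * \<alpha>\<^sup>2 > 0" using \<open>k \<ge> 3\<close> \<open>0 < \<alpha>\<close> by (simp add: c_def)
  moreover have "(\<Sum>v\<in>verts ?G1. real (vdegree ?G1 v) ^ 2) < (\<Sum>v\<in>verts ?G2. real (vdegree ?G2 v) ^ 2)"
  proof -
    \<comment> \<open>Let h be the degree of \<open>v\<^sub>0\<close> and p that of the path vertex.
      Merging adds (p + h)^2 - p^2 = 2ph + h^2, where p is 1 at \<open>w\<close> and at least 2 at
      \<open>u\<close>; h \<ge> 1 gives strictness.\<close>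
    have "real (vdegree H\<^sub>0 v\<^sub>0) < real (vdegree P u) * real (vdegree H\<^sub>0 v\<^sub>0)"
      using deg_u \<open>vdegree H\<^sub>0 v\<^sub>0 \<ge> 1\<close> by simp
    then show ?thesis
      unfolding sums[OF u(1), of "\<lambda>d. real d ^ 2"] sums[OF w(1), of "\<lambda>d. real d ^ 2"]
      by (simp add: w(2) power2_sum)
  qed
  ultimately have tr2: "Tr k (verts ?G1) 2 (A_alpha \<alpha> k ?G1) < Tr k (verts ?G2) 2 (A_alpha \<alpha> k ?G2)"
    by (simp add: tr mult_strict_left_mono)
  \<comment> \<open>For first powers merging adds the degree of \<open>v\<^sub>0\<close>, wherever
    it is attached.\<close>
  have tr1: "Tr k (verts ?G1) 1 (A_alpha \<alpha> k ?G1) = Tr k (verts ?G2) 1 (A_alpha \<alpha> k ?G2)"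
    using sums[OF u(1), of real] sums[OF w(1), of real] by (simp add: tr)
  \<comment> \<open>For \<open>t = 0\<close> the trace depends only on \<open>k\<close> and the
    number of vertices.\<close>
  have "Tr k (verts ?G1) t (A_alpha \<alpha> k ?G1) = Tr k (verts ?G2) t (A_alpha \<alpha> k ?G2)" if "t < 2" for t
    using that tr1 V by (cases t) (auto simp: Tr_def less_Suc_eq)
  with tr2 range show ?thesis
    unfolding S_less_def n_def using unif V by (intro conjI bexI[of _ 2]) auto
qed

end
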